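(* Let $G$ be a nice graph of order $n$ and maximum degree at most $\Delta$. Then there is a linear ordering of the vertices of $G$ such that the greedy algorithm applied to this ordering yields a proper pushing scheme $\rho:V(G)\to\mathbb{N}_0$ with $$P^t(G)\leq \sum_{u\in V(G)}\rho(u)\leq \sum_{u\in V(G)}\frac{1}{6}d_G(u)\bigl(2d_G(u)+1\bigr)\leq \frac{n\Delta(2\Delta+1)}{6}.$$
   Context: Graphs are finite, simple and undirected; $\mathbb{N}_0=\{0,1,2,\dots\}$. A graph is nice if it has no connected component of order two. For $\rho:V(G)\to\mathbb{N}_0$ define $\sigma_\rho:V(G)\to\mathbb{N}_0$ by $\sigma_\rho(u)=(1+\rho(u))d_G(u)+\sum_{v\in N_G(u)}\rho(v)$. The function $\rho$ is a proper pushing scheme of $G$ if $\sigma_\rho(u)\neq\sigma_\rho(v)$ for every edge $uv$. For a nice graph $G$, $P^t(G)=\min\{\sum_{u\in V(G)}\rho(u):\rho \text{ a proper pushing scheme of } G\}$. Greedy algorithm: given a linear ordering $u_1,\dots,u_n$ of $V(G)$, let $\rho_0\equiv 0$; for $i=1,\dots,n$, let $\rho_i$ agree with $\rho_{i-1}$ on all vertices except $u_i$, and set $\rho_i(u_i)=s$, where $s$ is the smallest non-negative integer such that there is no edge $u_ju_k$ with $j,k\le i$ and $\sigma_{\rho_i}(u_j)=\sigma_{\rho_i}(u_k)$ (such an $s$ always exists when $G$ is nice). The output is $\rho_n$, which is a proper pushing scheme. *)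

theory Defs
  imports Complex_Main "Graph_Theory.Digraph_Component"
begin

text \<open>
  A finite simple undirected graph is a \<^locale>\<open>pair_graph\<close>: a finite loop-free symmetric
  digraph whose arcs are ordered pairs, so an edge between \<open>u\<close> and \<open>v\<close> is present as both
  \<open>(u, v)\<close> and \<open>(v, u)\<close>, and the degree of a vertex is its out-degree.
\<close>

abbreviation deg :: "'a pair_pre_digraph \<Rightarrow> 'a \<Rightarrow> nat" where
  "deg G u \<equiv> out_degree (with_proj G) u"

definition nbrs :: "'a pair_pre_digraph \<Rightarrow> 'a \<Rightarrow> 'a set" where
  "nbrs G u = {v. (u, v) \<in> parcs G}"

definition connected_component :: "'a pair_pre_digraph \<Rightarrow> ('a, 'a \<times> 'a) pre_digraph \<Rightarrow> bool" where
  "connected_component G C \<longleftrightarrow> pre_digraph.max_subgraph (with_proj G) connected C"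

definition nice :: "'a pair_pre_digraph \<Rightarrow> bool" where
  "nice G \<longleftrightarrow> \<not> (\<exists>C. connected_component G C \<and> card (verts C) = 2)"

definition sigma :: "'a pair_pre_digraph \<Rightarrow> ('a \<Rightarrow> nat) \<Rightarrow> 'a \<Rightarrow> nat" where
  "sigma G \<rho> u = (1 + \<rho> u) * deg G u + (\<Sum>v\<in>nbrs G u. \<rho> v)"

definition proper_pushing_scheme :: "'a pair_pre_digraph \<Rightarrow> ('a \<Rightarrow> nat) \<Rightarrow> bool" where
  "proper_pushing_scheme G \<rho> \<longleftrightarrow> (\<forall>(u, v) \<in> parcs G. sigma G \<rho> u \<noteq> sigma G \<rho> v)"

definition total_pushing_number :: "'a pair_pre_digraph \<Rightarrow> nat" where
  "total_pushing_number G =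
     (LEAST k. \<exists>\<rho>. proper_pushing_scheme G \<rho> \<and> k = (\<Sum>u\<in>pverts G. \<rho> u))"

definition conflict_free_on :: "'a pair_pre_digraph \<Rightarrow> 'a set \<Rightarrow> ('a \<Rightarrow> nat) \<Rightarrow> bool" where
  "conflict_free_on G S \<rho> \<longleftrightarrow>
     (\<forall>(u, v) \<in> parcs G. u \<in> S \<and> v \<in> S \<longrightarrow> sigma G \<rho> u \<noteq> sigma G \<rho> v)"

text \<open>
  \<open>greedy G us \<rho>\<close>: the greedy algorithm, having processed the vertices \<open>us\<close> in this order,
  has produced \<open>\<rho>\<close>. The relation is functional in \<open>\<rho>\<close>. It is used instead of a function
  defined with \<^const>\<open>Least\<close> so that a run exists only if an admissible value exists
  in every step.
\<close>

inductive greedy :: "'a pair_pre_digraph \<Rightarrow> 'a list \<Rightarrow> ('a \<Rightarrow> nat) \<Rightarrow> bool" for G where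
  start: "greedy G [] (\<lambda>_. 0)"
| step: "greedy G us \<rho> \<Longrightarrow>
    conflict_free_on G (set (us @ [u])) (\<rho>(u := s)) \<Longrightarrow>
    (\<And>t. t < s \<Longrightarrow> \<not> conflict_free_on G (set (us @ [u])) (\<rho>(u := t))) \<Longrightarrow>
    greedy G (us @ [u]) (\<rho>(u := s))"

lemma greedy_functional: "greedy G us \<rho> \<Longrightarrow> greedy G us \<rho>' \<Longrightarrow> \<rho> = \<rho>'"
proof (induction arbitrary: \<rho>' rule: greedy.induct)
  case start
  then show ?case by (auto elim: greedy.cases)
next
  case (step us \<rho> u s)
  from step.prems obtain \<rho>0 t where r: "\<rho>' = \<rho>0(u := t)" "greedy G us \<rho>0"
      "conflict_free_on G (set (us @ [u])) (\<rho>0(u := t))"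
      "\<And>t'. t' < t \<Longrightarrow> \<not> conflict_free_on G (set (us @ [u])) (\<rho>0(u := t'))"
    by (cases rule: greedy.cases) auto
  have "\<rho>0 = \<rho>" using step.IH r(2) by blast
  moreover have "t = s"
    using r(3,4) step.hyps(2,3) \<open>\<rho>0 = \<rho>\<close> by (metis linorder_neqE_nat)
  ultimately show ?case using r(1) by simp
qed

end

theory Submission
  imports Defs
begin

text \<open>
  When the greedy algorithm reaches \<open>u\<close>, every edge from \<open>u\<close> to a processed vertex and every
  path \<open>u, v, w\<close> of processed vertices excludes at most one value of \<open>\<rho> u\<close>; if \<open>d(u) = 1\<close>, the edge
  \<open>uv\<close> excludes none, because niceness gives \<open>d(v) \<ge> 2\<close> and hence \<open>\<sigma>(u) < \<sigma>(v)\<close>. In a uniformly random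
  ordering an edge \<open>uv\<close> is charged once, and a path is charged for each of its two ends with
  probability 1/3, so the expected total is at most \<open>\<Sum> d(u)/2 + d(u)(d(u)-1)/3\<close>, the claimed bound.
  The averaging is carried out one vertex at a time, choosing the last vertex of the ordering first.
\<close>

section \<open>Ordered edges and two-edge paths inside a vertex set\<close>

text \<open>For a symmetric \<open>E\<close> each edge occurs here in both orientations, and in
  \<open>paths_in\<close> each path occurs once from either end. The probabilities 1/2 and 1/3
  therefore become the weights 3 and 2 after multiplication by 6, which keeps the counting in the
  natural numbers.\<close>

definition arcs_in :: "'a rel \<Rightarrow> 'a set \<Rightarrow> ('a \<times> 'a) set" where
  "arcs_in E S = {(u, v). (u, v) \<in> E \<and> u \<in> S \<and> v \<in> S}"

definition paths_in :: "'a rel \<Rightarrow> 'a set \<Rightarrow> ('a \<times> 'a \<times> 'a) set" where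
  "paths_in E S = {(u, v, w). (u, v) \<in> E \<and> (v, w) \<in> E \<and> u \<noteq> w \<and> u \<in> S \<and> v \<in> S \<and> w \<in> S}"

lemma finite_arcs_in: "finite S \<Longrightarrow> finite (arcs_in E S)"
  by (rule finite_subset[of _ "S \<times> S"]) (auto simp: arcs_in_def)

lemma finite_paths_in: "finite S \<Longrightarrow> finite (paths_in E S)"
  by (rule finite_subset[of _ "S \<times> S \<times> S"]) (auto simp: paths_in_def)

text \<open>Double counting of incidences: an arc has one tail and, in the absence of loops, two
  distinct vertices.\<close>

lemma sum_card_arcs_in_at:
  assumes "finite S" "irrefl E"
  shows "(\<Sum>x\<in>S. card {p \<in> arcs_in E S. fst p = x}) = card (arcs_in E S)"
    and "(\<Sum>x\<in>S. card {p \<in> arcs_in E S. x \<in> {fst p, snd p}}) = 2 * card (arcs_in E S)"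
proof -
  have "{x \<in> S. fst p = x} = {fst p}" if "p \<in> arcs_in E S" for p
    using that by (auto simp: arcs_in_def)
  then show "(\<Sum>x\<in>S. card {p \<in> arcs_in E S. fst p = x}) = card (arcs_in E S)"
    using sum_multicount[OF assms(1) finite_arcs_in[OF assms(1)], of E "\<lambda>x p. fst p = x" 1] by simp
  have "card {x \<in> S. x \<in> {fst p, snd p}} = 2" if "p \<in> arcs_in E S" for p
  proof -
    have "{x \<in> S. x \<in> {fst p, snd p}} = {fst p, snd p}" "fst p \<noteq> snd p"
      using that assms(2) by (auto simp: arcs_in_def irrefl_def)
    then show ?thesis by simp
  qed
  then have "\<forall>p\<in>arcs_in E S. card {x \<in> S. x \<in> {fst p, snd p}} = 2" ..
  then show "(\<Sum>x\<in>S. card {p \<in> arcs_in E S. x \<in> {fst p, snd p}}) = 2 * card (arcs_in E S)"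
    by (rule sum_multicount[OF assms(1) finite_arcs_in[OF assms(1)]])
qed

text \<open>The same double count for paths, which have one start and three distinct
  vertices.\<close>

lemma sum_card_paths_in_at:
  assumes "finite S" "irrefl E"
  shows "(\<Sum>x\<in>S. card {t \<in> paths_in E S. fst t = x}) = card (paths_in E S)"
    and "(\<Sum>x\<in>S. card {t \<in> paths_in E S. x \<in> {fst t, fst (snd t), snd (snd t)}}) =
      3 * card (paths_in E S)"
proof -
  have "{x \<in> S. fst t = x} = {fst t}" if "t \<in> paths_in E S" for t
    using that by (auto simp: paths_in_def)
  then show "(\<Sum>x\<in>S. card {t \<in> paths_in E S. fst t = x}) = card (paths_in E S)"
    using sum_multicount[OF assms(1) finite_paths_in[OF assms(1)], of E "\<lambda>x t. fst t = x" 1] by simp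
  have "card {x \<in> S. x \<in> {fst t, fst (snd t), snd (snd t)}} = 3" if "t \<in> paths_in E S" for t
  proof -
    have "{x \<in> S. x \<in> {fst t, fst (snd t), snd (snd t)}} = {fst t, fst (snd t), snd (snd t)}"
      "fst t \<noteq> fst (snd t)" "fst t \<noteq> snd (snd t)" "fst (snd t) \<noteq> snd (snd t)"
      using that assms(2) by (auto simp: paths_in_def irrefl_def)
    then show ?thesis by simp
  qed
  then have "\<forall>t\<in>paths_in E S. card {x \<in> S. x \<in> {fst t, fst (snd t), snd (snd t)}} = 3" ..
  then show "(\<Sum>x\<in>S. card {t \<in> paths_in E S. x \<in> {fst t, fst (snd t), snd (snd t)}}) =
      3 * card (paths_in E S)"
    by (rule sum_multicount[OF assms(1) finite_paths_in[OF assms(1)]])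
qed

lemma card_arcs_in_remove:
  assumes "finite S"
  shows "card (arcs_in E S) =
    card (arcs_in E (S - {x})) + card {p \<in> arcs_in E S. x \<in> {fst p, snd p}}"
proof -
  let ?T = "{p \<in> arcs_in E S. x \<in> {fst p, snd p}}"
  have split: "arcs_in E (S - {x}) \<union> ?T = arcs_in E S" by (auto simp: arcs_in_def)
  have disj: "arcs_in E (S - {x}) \<inter> ?T = {}" by (auto simp: arcs_in_def)
  have fin: "finite (arcs_in E (S - {x}))" "finite ?T"
    using assms by (simp_all add: finite_arcs_in)
  show ?thesis using card_Un_disjoint[OF fin disj] by (simp only: split)
qed

lemma card_paths_in_remove:
  assumes "finite S"
  shows "card (paths_in E S) = card (paths_in E (S - {x})) +
    card {t \<in> paths_in E S. x \<in> {fst t, fst (snd t), snd (snd t)}}"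
proof -
  let ?T = "{t \<in> paths_in E S. x \<in> {fst t, fst (snd t), snd (snd t)}}"
  have split: "paths_in E (S - {x}) \<union> ?T = paths_in E S" by (auto simp: paths_in_def)
  have disj: "paths_in E (S - {x}) \<inter> ?T = {}" by (auto simp: paths_in_def)
  have fin: "finite (paths_in E (S - {x}))" "finite ?T"
    using assms by (simp_all add: finite_paths_in)
  show ?thesis using card_Un_disjoint[OF fin disj] by (simp only: split)
qed

section \<open>Averaging over the last vertex\<close>

text \<open>Summed over \<open>x\<close>, the charge for placing \<open>x\<close> last and the drop
  in the potential 3 arcs + 2 paths agree: 3 * 2 = 6 for arcs and 2 * 3 = 6 for paths. So the charge
  cannot exceed the drop at every \<open>x\<close>.\<close>

lemma exists_cheap_last_vertex:
  assumes "finite S" "S \<noteq> {}" "irrefl E"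
  shows "\<exists>x\<in>S. 6 * (card {p \<in> arcs_in E S. fst p = x} + card {t \<in> paths_in E S. fst t = x}) +
      3 * card (arcs_in E (S - {x})) + 2 * card (paths_in E (S - {x}))
    \<le> 3 * card (arcs_in E S) + 2 * card (paths_in E S)"
proof (rule ccontr)
  let ?c = "\<lambda>x. 6 * card {p \<in> arcs_in E S. fst p = x} + 6 * card {t \<in> paths_in E S. fst t = x}"
  let ?d = "\<lambda>x. 3 * card {p \<in> arcs_in E S. x \<in> {fst p, snd p}} +
      2 * card {t \<in> paths_in E S. x \<in> {fst t, fst (snd t), snd (snd t)}}"
  assume contra: "\<not> ?thesis"
  \<comment> \<open>The removal identities cancel the terms for \<open>S - {x}\<close>, leaving only
    the arcs and paths through \<open>x\<close>.\<close>
  have "?d x < ?c x" if "x \<in> S" for x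
    using contra that card_arcs_in_remove[OF assms(1), of E x]
      card_paths_in_remove[OF assms(1), of E x]
    by (force simp: not_le)
  then have "sum ?d S < sum ?c S"
    using assms by (intro sum_strict_mono) auto
  moreover have "sum ?d S = 6 * card (arcs_in E S) + 6 * card (paths_in E S)"
    unfolding sum.distrib sum_distrib_left[symmetric]
    using sum_card_arcs_in_at(2)[OF assms(1,3)] sum_card_paths_in_at(2)[OF assms(1,3)] by simp
  moreover have "sum ?c S = 6 * card (arcs_in E S) + 6 * card (paths_in E S)"
    unfolding sum.distrib sum_distrib_left[symmetric]
    using sum_card_arcs_in_at(1)[OF assms(1,3)] sum_card_paths_in_at(1)[OF assms(1,3)] by simp
  ultimately show False by simp
qed

section \<open>Counting forbidden values\<close>

text \<open>All values below the least one outside \<open>B\<close> lie in \<open>B\<close>, so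
  there are at most \<open>card B\<close> of them.\<close>

lemma Least_avoiding_le_card:
  fixes B :: "nat set"
  assumes "finite B"
  shows "\<exists>s. s \<notin> B \<and> (\<forall>t<s. t \<in> B) \<and> s \<le> card B"
proof -
  have "\<exists>s. s \<notin> B" using ex_new_if_finite[OF infinite_UNIV_nat assms] .
  then obtain s where s: "s \<notin> B" "\<forall>t<s. t \<in> B"
    unfolding exists_least_iff[of "\<lambda>s. s \<notin> B"] by blast
  then have "{..<s} \<subseteq> B" by auto
  from card_mono[OF assms this] have "s \<le> card B" by simp
  with s show ?thesis by blast
qed

text \<open>Each index stands for a potential conflict that forbids at most one value, possibly
  none.\<close>

lemma card_le_if_subset_UN:
  assumes "finite I" "\<And>i. i \<in> I \<Longrightarrow> \<exists>a. A i \<subseteq> {a}" "B \<subseteq> (\<Union>i\<in>I. A i)"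
  shows "finite B \<and> card B \<le> card I"
proof -
  from assms(2) obtain f where f: "\<And>i. i \<in> I \<Longrightarrow> A i \<subseteq> {f i}" by metis
  then have "B \<subseteq> f ` I" using assms(3) by blast
  then show ?thesis using assms(1) by (meson finite_imageI finite_subset surj_card_le)
qed

section \<open>Degrees and the effect of one push\<close>

lemma deg_eq_card_nbrs: "deg G u = card (nbrs G u)"
proof -
  have "out_arcs (with_proj G) u = Pair u ` nbrs G u"
    by (auto simp: out_arcs_def nbrs_def)
  then show ?thesis by (simp add: out_degree_def card_image inj_on_def)
qed

context pair_graph
begin

lemma arc_sym: "(u, v) \<in> parcs G \<longleftrightarrow> (v, u) \<in> parcs G"
  using pair_sym_arcs by (auto simp: symmetric_def dest: symD)

lemma irrefl_parcs: "irrefl (parcs G)"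
  using pair_no_loops by (force simp: irrefl_def)

lemma nbrs_subset: "nbrs G u \<subseteq> pverts G"
  by (auto simp: nbrs_def dest: in_arcsD2)

lemma finite_nbrs: "finite (nbrs G u)"
  using nbrs_subset pair_finite_verts finite_subset by blast

lemma deg_pos: "(u, v) \<in> parcs G \<Longrightarrow> 0 < deg G u"
  using finite_nbrs[of u] by (auto simp: deg_eq_card_nbrs card_gt_0_iff nbrs_def)

lemma nbrs_eq_singleton:
  assumes "deg G u = 1" "(u, v) \<in> parcs G"
  shows "nbrs G u = {v}"
proof -
  have "v \<in> nbrs G u" using assms(2) by (simp add: nbrs_def)
  moreover obtain w where "nbrs G u = {w}"
    using assms(1) by (auto simp: deg_eq_card_nbrs card_1_singleton_iff)
  ultimately show ?thesis by simp
qed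

text \<open>Starting from \<open>\<rho> x = 0\<close>, as for an unprocessed vertex, makes the
  change in \<open>sigma\<close> additive and linear in \<open>s\<close>.\<close>

lemma sigma_fun_upd:
  assumes "\<rho> x = 0"
  shows "sigma G (\<rho>(x := s)) w = sigma G \<rho> w +
    (if w = x then s * deg G x else if (x, w) \<in> parcs G then s else 0)"
proof (cases "x \<in> nbrs G w")
  case True
  then have "w \<noteq> x" "(x, w) \<in> parcs G"
    using irrefl_parcs arc_sym by (auto simp: nbrs_def irrefl_def)
  then show ?thesis using True assms finite_nbrs[of w]
    by (simp add: sigma_def sum.remove[OF _ True])
next
  case False
  then have "(\<Sum>v\<in>nbrs G w. (\<rho>(x := s)) v) = (\<Sum>v\<in>nbrs G w. \<rho> v)"
    by (intro sum.cong) auto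
  then show ?thesis using False assms arc_sym
    by (auto simp: sigma_def nbrs_def algebra_simps)
qed

text \<open>Here \<open>sigma\<close> at \<open>u\<close> is 1 + \<open>\<rho> u\<close> +
  \<open>\<rho> v\<close>, while at \<open>v\<close> it is at least 2 * (1 +
  \<open>\<rho> v\<close>) + \<open>\<rho> u\<close>.\<close>

lemma sigma_pendant_less:
  assumes "(u, v) \<in> parcs G" "deg G u = 1" "deg G v \<noteq> 1"
  shows "sigma G \<rho> u < sigma G \<rho> v"
proof -
  have "2 \<le> deg G v" using assms arc_sym deg_pos[of v u] by force
  then have "(1 + \<rho> v) * 2 \<le> (1 + \<rho> v) * deg G v" by (rule mult_le_mono2)
  moreover have "\<rho> u \<le> (\<Sum>w\<in>nbrs G v. \<rho> w)"
    using assms(1) arc_sym by (intro member_le_sum finite_nbrs) (auto simp: nbrs_def)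
  ultimately show ?thesis
    using nbrs_eq_singleton[OF assms(2,1)] assms(2) by (simp add: sigma_def)
qed

section \<open>The greedy step and the greedy run\<close>

lemma exists_least_admissible:
  assumes pendant: "\<forall>(u, v)\<in>parcs G. deg G u = 1 \<longrightarrow> deg G v \<noteq> 1"
    and S: "finite S" "x \<in> S"
    and old: "conflict_free_on G (S - {x}) \<rho>" "\<rho> x = 0"
  shows "\<exists>s. conflict_free_on G S (\<rho>(x := s)) \<and>
    (\<forall>t<s. \<not> conflict_free_on G S (\<rho>(x := t))) \<and>
    s \<le> card {p \<in> arcs_in (parcs G) S. fst p = x} + card {t \<in> paths_in (parcs G) S. fst t = x}"
proof -
  let ?I = "{p \<in> arcs_in (parcs G) S. fst p = x}"
  let ?J = "{t \<in> paths_in (parcs G) S. fst t = x}"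
  let ?\<sigma> = "\<lambda>s. sigma G (\<rho>(x := s))"
  let ?A = "\<lambda>p. {s. ?\<sigma> s (fst p) = ?\<sigma> s (snd p)}"
  \<comment> \<open>If \<open>x\<close> is adjacent to both ends of an edge, both values of
    \<open>sigma\<close> rise by \<open>s\<close>, so that edge forbids nothing new.\<close>
  let ?C = "\<lambda>t. if (x, snd (snd t)) \<in> parcs G then {}
    else {s. ?\<sigma> s (fst (snd t)) = ?\<sigma> s (snd (snd t))}"
  let ?B = "{s. \<not> conflict_free_on G S (\<rho>(x := s))}"
  note upd = sigma_fun_upd[of \<rho> x, OF old(2)]
  have A: "\<exists>a. ?A p \<subseteq> {a}" if p: "p \<in> ?I" for p
  proof -
    obtain v where v: "p = (x, v)" "(x, v) \<in> parcs G" using p by (cases p) (auto simp: arcs_in_def)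
    then have "v \<noteq> x" using irrefl_parcs by (auto simp: irrefl_def)
    have "s = t" if "s \<in> ?A p" "t \<in> ?A p" for s t
    proof (cases "deg G x = 1")
      case True
      have "deg G v \<noteq> 1" using pendant v(2) True by blast
      then have "?\<sigma> s x < ?\<sigma> s v" by (rule sigma_pendant_less[OF v(2) True])
      \<comment> \<open>The two values never agree, so uniqueness of the forbidden value is
        vacuous.\<close>
      then show ?thesis using that(1) v(1) by simp
    next
      case False
      \<comment> \<open>The gap between \<open>sigma\<close> at \<open>x\<close> and at
        \<open>v\<close> grows by \<open>deg G x - 1 = Suc k\<close> per push; this rate is
        positive, so at most one \<open>s\<close> closes the gap.\<close>
      then obtain k where k: "deg G x = Suc (Suc k)"
        using deg_pos[OF v(2)] by (metis One_nat_def gr0_implies_Suc not0_implies_Suc)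
      have "s * Suc k + sigma G \<rho> x = sigma G \<rho> v" "t * Suc k + sigma G \<rho> x = sigma G \<rho> v"
        using that v \<open>v \<noteq> x\<close> k by (auto simp: upd)
      then have "s * Suc k = t * Suc k" by linarith
      then show ?thesis by (metis Suc_neq_Zero mult_cancel2)
    qed
    then show ?thesis by blast
  qed
  have C: "\<exists>a. ?C t \<subseteq> {a}" if t: "t \<in> ?J" for t
  proof -
    obtain v w where "t = (x, v, w)" "(x, v) \<in> parcs G" "x \<noteq> w"
      using t by (cases t) (auto simp: paths_in_def)
    moreover from this have "v \<noteq> x" using irrefl_parcs by (auto simp: irrefl_def)
    \<comment> \<open>Only \<open>v\<close> gains \<open>s\<close>, so equality forces this
      difference. If truncation makes it spurious, the set is empty and the inclusion still
      holds.\<close>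
    ultimately have "?C t \<subseteq> {sigma G \<rho> w - sigma G \<rho> v}" by (auto simp: upd)
    then show ?thesis by blast
  qed
  \<comment> \<open>The disjoint sum indexes arcs and paths together, and its cardinality is the sum
    of theirs.\<close>
  have cover: "?B \<subseteq> (\<Union>i\<in>?I <+> ?J. case i of Inl p \<Rightarrow> ?A p | Inr t \<Rightarrow> ?C t)"
  proof
    fix s assume "s \<in> ?B"
    then obtain a b where ab: "(a, b) \<in> parcs G" "a \<in> S" "b \<in> S" "?\<sigma> s a = ?\<sigma> s b"
      by (auto simp: conflict_free_on_def)
    have ba: "(b, a) \<in> parcs G" using ab arc_sym by blast
    consider "a = x" | "b = x" | "a \<noteq> x" "b \<noteq> x" "(x, a) \<in> parcs G" "(x, b) \<notin> parcs G"
      | "a \<noteq> x" "b \<noteq> x" "(x, b) \<in> parcs G" "(x, a) \<notin> parcs G"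
      | "a \<noteq> x" "b \<noteq> x" "(x, a) \<in> parcs G \<longleftrightarrow> (x, b) \<in> parcs G" by blast
    then have "(\<exists>p\<in>?I. s \<in> ?A p) \<or> (\<exists>t\<in>?J. s \<in> ?C t)"
    proof cases
      case 1
      then have "(x, b) \<in> ?I" "s \<in> ?A (x, b)" using ab by (auto simp: arcs_in_def)
      then show ?thesis by blast
    next
      case 2
      then have "(x, a) \<in> ?I" "s \<in> ?A (x, a)" using ab ba by (auto simp: arcs_in_def)
      then show ?thesis by blast
    next
      case 3
      then have "(x, a, b) \<in> ?J" "s \<in> ?C (x, a, b)" using ab S by (auto simp: paths_in_def)
      then show ?thesis by blast
    next
      case 4
      then have "(x, b, a) \<in> ?J" "s \<in> ?C (x, b, a)" using ab ba S by (auto simp: paths_in_def)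
      then show ?thesis by blast
    next
      case 5
      \<comment> \<open>Either both ends or neither gained \<open>s\<close>, so the conflict would
        already be present before \<open>x\<close> is processed.\<close>
      then have "sigma G \<rho> a = sigma G \<rho> b" using ab(4) by (auto simp: upd split: if_splits)
      then show ?thesis using old(1) ab 5 by (auto simp: conflict_free_on_def)
    qed
    then show "s \<in> (\<Union>i\<in>?I <+> ?J. case i of Inl p \<Rightarrow> ?A p | Inr t \<Rightarrow> ?C t)"
    proof (elim disjE bexE)
      fix p assume "p \<in> ?I" "s \<in> ?A p"
      then show ?thesis by (intro UN_I[of "Inl p"] InlI) simp_all
    next
      fix t assume "t \<in> ?J" "s \<in> ?C t"
      then show ?thesis by (intro UN_I[of "Inr t"] InrI) (simp_all only: sum.case)
    qed
  qed
  have fin: "finite ?I" "finite ?J"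
    using finite_arcs_in[OF S(1)] finite_paths_in[OF S(1)] by auto
  have "\<exists>a. (case i of Inl p \<Rightarrow> ?A p | Inr t \<Rightarrow> ?C t) \<subseteq> {a}" if "i \<in> ?I <+> ?J" for i
    using that A C by (elim PlusE) (simp_all only: sum.case)
  then have "finite ?B \<and> card ?B \<le> card (?I <+> ?J)"
    by (rule card_le_if_subset_UN[OF finite_Plus[OF fin] _ cover])
  then have B: "finite ?B" "card ?B \<le> card ?I + card ?J"
    using card_Plus[OF fin] by simp_all
  from Least_avoiding_le_card[OF B(1)] obtain s
    where "s \<notin> ?B" "\<forall>t<s. t \<in> ?B" "s \<le> card ?B" by blast
  then show ?thesis using B(2) by (intro exI[of _ s]) simp
qed

text \<open>Induction peels off the cheap vertex, which the greedy algorithm processes after all the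
  others. That \<open>\<rho>\<close> vanishes off \<open>S\<close> guarantees the value 0 at the
  next vertex.\<close>

lemma exists_cheap_greedy_run:
  assumes pendant: "\<forall>(u, v)\<in>parcs G. deg G u = 1 \<longrightarrow> deg G v \<noteq> 1"
    and "finite S"
  shows "\<exists>us \<rho>. distinct us \<and> set us = S \<and> greedy G us \<rho> \<and> conflict_free_on G S \<rho> \<and>
    (\<forall>v. v \<notin> S \<longrightarrow> \<rho> v = 0) \<and>
    6 * sum \<rho> S \<le> 3 * card (arcs_in (parcs G) S) + 2 * card (paths_in (parcs G) S)"
  using assms(2)
proof (induction S rule: finite_psubset_induct)
  case (psubset S)
  show ?case
  proof (cases "S = {}")
    case True
    then show ?thesis
      by (intro exI[of _ "[]"] exI[of _ "\<lambda>_. 0"]) (auto simp: conflict_free_on_def greedy.start)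
  next
    case False
    let ?E = "parcs G"
    obtain x where x: "x \<in> S" and cheap:
      "6 * (card {p \<in> arcs_in ?E S. fst p = x} + card {t \<in> paths_in ?E S. fst t = x}) +
        3 * card (arcs_in ?E (S - {x})) + 2 * card (paths_in ?E (S - {x}))
      \<le> 3 * card (arcs_in ?E S) + 2 * card (paths_in ?E S)"
      using exists_cheap_last_vertex[OF psubset.hyps False irrefl_parcs] by blast
    from x have "S - {x} \<subset> S" by blast
    from psubset.IH[OF this] obtain us \<rho> where us: "distinct us" "set us = S - {x}"
      and run: "greedy G us \<rho>" "conflict_free_on G (S - {x}) \<rho>" "\<forall>v. v \<notin> S - {x} \<longrightarrow> \<rho> v = 0"
      and cost: "6 * sum \<rho> (S - {x}) \<le>
        3 * card (arcs_in ?E (S - {x})) + 2 * card (paths_in ?E (S - {x}))"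
      by blast
    have set: "set (us @ [x]) = S" using us x by auto
    have "\<rho> x = 0" using run(3) by simp
    from exists_least_admissible[OF pendant psubset.hyps x run(2) this]
    obtain s where s: "conflict_free_on G S (\<rho>(x := s))"
        "\<forall>t<s. \<not> conflict_free_on G S (\<rho>(x := t))"
        "s \<le> card {p \<in> arcs_in ?E S. fst p = x} + card {t \<in> paths_in ?E S. fst t = x}"
      by blast
    have total: "sum (\<rho>(x := s)) S = s + sum \<rho> (S - {x})"
      using psubset.hyps x by (simp add: sum.remove)
    have "6 * sum (\<rho>(x := s)) S \<le>
        6 * (card {p \<in> arcs_in ?E S. fst p = x} + card {t \<in> paths_in ?E S. fst t = x}) +
        (3 * card (arcs_in ?E (S - {x})) + 2 * card (paths_in ?E (S - {x})))"
      unfolding total distrib_left[of 6 s] by (intro add_mono mult_le_mono2 s(3) cost)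
    also have "\<dots> \<le> 3 * card (arcs_in ?E S) + 2 * card (paths_in ?E S)"
      using cheap by (simp only: add.assoc)
    finally have "6 * sum (\<rho>(x := s)) S \<le>
        3 * card (arcs_in ?E S) + 2 * card (paths_in ?E S)" .
    moreover have "greedy G (us @ [x]) (\<rho>(x := s))"
      using greedy.step[OF run(1), of x s] s(1,2) set by simp
    moreover have "\<forall>v. v \<notin> S \<longrightarrow> (\<rho>(x := s)) v = 0" using run(3) x by auto
    moreover have "distinct (us @ [x])" using us by simp
    ultimately show ?thesis using s(1) set by blast
  qed
qed

section \<open>Degree sums\<close>

lemma card_arcs_in_pverts: "card (arcs_in (parcs G) (pverts G)) = (\<Sum>v\<in>pverts G. deg G v)"
proof -
  have "arcs_in (parcs G) (pverts G) = (SIGMA v:pverts G. nbrs G v)"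
    using wellformed' by (auto simp: arcs_in_def nbrs_def)
  then show ?thesis
    using pair_finite_verts finite_nbrs by (simp add: deg_eq_card_nbrs)
qed

text \<open>Paths are grouped by their middle vertex: one neighbour is chosen as start, then a
  different one as end.\<close>

lemma card_paths_in_pverts:
  "card (paths_in (parcs G) (pverts G)) = (\<Sum>v\<in>pverts G. deg G v * (deg G v - 1))"
proof -
  let ?P = "SIGMA v:pverts G. SIGMA u:nbrs G v. nbrs G v - {u}"
  have "paths_in (parcs G) (pverts G) = (\<lambda>(v, u, w). (u, v, w)) ` ?P"
    using wellformed' arc_sym by (force simp: paths_in_def nbrs_def)
  moreover have "inj_on (\<lambda>(v, u, w). (u, v, w)) ?P" by (auto simp: inj_on_def)
  ultimately have "card (paths_in (parcs G) (pverts G)) = card ?P"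
    by (simp add: card_image)
  also have "\<dots> = (\<Sum>v\<in>pverts G. \<Sum>u\<in>nbrs G v. card (nbrs G v - {u}))"
    using pair_finite_verts finite_nbrs by simp
  also have "\<dots> = (\<Sum>v\<in>pverts G. deg G v * (deg G v - 1))"
    using finite_nbrs by (simp add: deg_eq_card_nbrs)
  finally show ?thesis .
qed

section \<open>Components of order two\<close>

text \<open>No arc of \<open>G\<close> leaves \<open>{u, v}\<close>, so no connected subgraph can
  properly extend this edge.\<close>

lemma pendant_edge_component:
  assumes uv: "(u, v) \<in> parcs G" and deg: "deg G u = 1" "deg G v = 1"
  shows "connected_component G (with_proj \<lparr>pverts = {u, v}, parcs = {(u, v), (v, u)}\<rparr>)"
proof -
  let ?C = "with_proj \<lparr>pverts = {u, v}, parcs = {(u, v), (v, u)}\<rparr>"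
  have vu: "(v, u) \<in> parcs G" using uv arc_sym by blast
  have wf: "wf_digraph ?C" by unfold_locales auto
  have sub: "subgraph ?C G"
    using uv vu wf wellformed' wf_digraph_axioms by (auto simp: subgraph_def compatible_def)
  \<comment> \<open>Connectedness is strong connectedness of the symmetric closure, and this graph
    is its own closure.\<close>
  have sym: "with_proj (mk_symmetric ?C) = ?C" by (auto simp: mk_symmetric_def with_proj_def)
  have "u \<rightarrow>\<^sup>*\<^bsub>?C\<^esub> v" "v \<rightarrow>\<^sup>*\<^bsub>?C\<^esub> u" "u \<rightarrow>\<^sup>*\<^bsub>?C\<^esub> u" "v \<rightarrow>\<^sup>*\<^bsub>?C\<^esub> v"
    using wf_digraph.reachable_adjI[OF wf, of u v] wf_digraph.reachable_adjI[OF wf, of v u]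
      wf_digraph.reachable_refl[OF wf, of u] wf_digraph.reachable_refl[OF wf, of v]
    by simp_all
  then have conn: "connected ?C"
    unfolding connected_def sym by (auto simp: strongly_connected_def)
  have closed: "b \<in> {u, v}" if "(a, b) \<in> parcs G" "a \<in> {u, v}" for a b
    using that nbrs_eq_singleton[OF deg(1) uv] nbrs_eq_singleton[OF deg(2) vu]
    by (auto simp: nbrs_def)
  have "H = ?C" if H: "subgraph ?C H" "subgraph H G" "connected H" for H
  proof -
    have arcs: "arcs H \<subseteq> parcs G" and tail: "tail H = fst" and head: "head H = snd"
      using H(2) by (auto simp: subgraph_def compatible_def)
    have wf_sym: "wf_digraph (with_proj (mk_symmetric H))"
      using H(2) by (simp add: subgraph_def wf_digraph_wp_iff wf_digraph.wellformed_mk_symmetric)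
    \<comment> \<open>Walks from \<open>u\<close> in the symmetric closure of \<open>H\<close> use
      arcs of \<open>G\<close> only, hence stay in \<open>{u, v}\<close>.\<close>
    have "verts H \<subseteq> {u, v}"
    proof
      fix w assume "w \<in> verts H"
      moreover have "u \<in> verts H" using H(1) by (auto simp: subgraph_def)
      ultimately have "u \<rightarrow>\<^sup>*\<^bsub>with_proj (mk_symmetric H)\<^esub> w"
        using H(3) by (auto simp: connected_def strongly_connected_def mk_symmetric_def)
      with wf_sym show "w \<in> {u, v}"
      proof (induction rule: wf_digraph.reachable_induct[consumes 2, case_names base step])
        case base
        show ?case by simp
      next
        case (step a b)
        then have "(a, b) \<in> parcs G"
          using arcs arc_sym by (auto simp: mk_symmetric_def tail head)
        then show ?case using step closed by blast
      qed
    qed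
    then have verts: "verts H = {u, v}" using H(1) by (auto simp: subgraph_def)
    have "e \<in> {(u, v), (v, u)}" if "e \<in> arcs H" for e
    proof -
      have "wf_digraph H" using H(2) by (simp add: subgraph_def)
      from wf_digraph.wellformed[OF this that] have "fst e \<in> {u, v}" "snd e \<in> {u, v}"
        by (simp_all only: verts tail head)
      moreover have "fst e \<noteq> snd e" using that arcs pair_no_loops by blast
      ultimately show ?thesis by (cases e) auto
    qed
    then have "arcs H = {(u, v), (v, u)}" using H(1) by (auto simp: subgraph_def)
    with verts tail head show ?thesis by (simp add: with_proj_def)
  qed
  then show ?thesis
    using sub conn by (auto simp: connected_component_def pre_digraph.max_subgraph_def)
qed

text \<open>This is the only form in which niceness enters the greedy analysis.\<close>

lemma nice_deg_ne_1:
  assumes "nice G"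
  shows "\<forall>(u, v)\<in>parcs G. deg G u = 1 \<longrightarrow> deg G v \<noteq> 1"
proof (clarify)
  fix u v assume uv: "(u, v) \<in> parcs G" "deg G u = 1" "deg G v = 1"
  have "card {u, v} \<noteq> 2"
    using assms pendant_edge_component[OF uv] by (force simp: nice_def)
  moreover have "u \<noteq> v" using uv(1) irrefl_parcs by (auto simp: irrefl_def)
  ultimately show False by simp
qed

end

section \<open>The bound in terms of degrees\<close>

theorem theorem2:
  fixes G :: "'a pair_pre_digraph" and n \<Delta> :: nat
  assumes "pair_graph G"
    and "nice G"
    and "card (pverts G) = n"
    and "\<forall>u\<in>pverts G. deg G u \<le> \<Delta>"
  shows "\<exists>us \<rho>. distinct us \<and> set us = pverts G \<and> greedy G us \<rho> \<and>
    proper_pushing_scheme G \<rho> \<and>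
    real (total_pushing_number G) \<le> real (\<Sum>u\<in>pverts G. \<rho> u) \<and>
    real (\<Sum>u\<in>pverts G. \<rho> u) \<le>
      (\<Sum>u\<in>pverts G. 1 / 6 * real (deg G u) * (2 * real (deg G u) + 1)) \<and>
    (\<Sum>u\<in>pverts G. 1 / 6 * real (deg G u) * (2 * real (deg G u) + 1)) \<le>
      real n * real \<Delta> * (2 * real \<Delta> + 1) / 6"
proof -
  interpret pair_graph G by fact
  obtain us \<rho> where us: "distinct us" "set us = pverts G" and run: "greedy G us \<rho>"
    and cf: "conflict_free_on G (pverts G) \<rho>"
    and cost: "6 * sum \<rho> (pverts G) \<le>
      3 * card (arcs_in (parcs G) (pverts G)) + 2 * card (paths_in (parcs G) (pverts G))"
    using exists_cheap_greedy_run[OF nice_deg_ne_1[OF assms(2)] pair_finite_verts] by blast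
  have proper: "proper_pushing_scheme G \<rho>"
    using cf wellformed' by (auto simp: conflict_free_on_def proper_pushing_scheme_def)
  have "total_pushing_number G \<le> sum \<rho> (pverts G)"
    unfolding total_pushing_number_def using proper by (intro Least_le) blast
  moreover have "real (sum \<rho> (pverts G)) \<le>
      (\<Sum>u\<in>pverts G. 1 / 6 * real (deg G u) * (2 * real (deg G u) + 1))"
  proof -
    have "6 * sum \<rho> (pverts G) \<le> (\<Sum>u\<in>pverts G. 3 * deg G u + 2 * (deg G u * (deg G u - 1)))"
      using cost
      by (simp add: card_arcs_in_pverts card_paths_in_pverts sum.distrib sum_distrib_left)
    also have "\<dots> = (\<Sum>u\<in>pverts G. deg G u * (2 * deg G u + 1))"
    proof (rule sum.cong[OF refl])
      fix u
      show "3 * deg G u + 2 * (deg G u * (deg G u - 1)) = deg G u * (2 * deg G u + 1)"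
        \<comment> \<open>The case split deals with the truncated subtraction at degree 0.\<close>
        by (cases "deg G u") (simp_all add: algebra_simps)
    qed
    finally have "real (6 * sum \<rho> (pverts G)) \<le>
        real (\<Sum>u\<in>pverts G. deg G u * (2 * deg G u + 1))"
      by (rule of_nat_mono)
    also have "\<dots> = 6 * (\<Sum>u\<in>pverts G. 1 / 6 * real (deg G u) * (2 * real (deg G u) + 1))"
      by (simp add: sum_distrib_left algebra_simps)
    finally show ?thesis by simp
  qed
  moreover have "(\<Sum>u\<in>pverts G. 1 / 6 * real (deg G u) * (2 * real (deg G u) + 1)) \<le>
      real n * real \<Delta> * (2 * real \<Delta> + 1) / 6"
  proof -
    have "(\<Sum>u\<in>pverts G. 1 / 6 * real (deg G u) * (2 * real (deg G u) + 1)) \<le>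
        (\<Sum>u\<in>pverts G. 1 / 6 * real \<Delta> * (2 * real \<Delta> + 1))"
      using assms(4) by (intro sum_mono mult_mono) auto
    then show ?thesis using assms(3) by simp
  qed
  ultimately show ?thesis
    using us run proper by (intro exI[of _ us] exI[of _ \<rho>] conjI) (simp_all only: of_nat_le_iff)
qed

end
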